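(* Let $n\ge 2$ and $m\ge 0$ be integers, let $X$ be an algebraic system, and let $X_0,X_1,\dots,X_m$ be subsets of $X$ containing elements $x^i_1,\dots,x^i_n\in X_i$ ($i=0,1,\dots,m$) such that $\{x^i_1,\dots,x^i_n\}\cap\{x^k_1,\dots,x^k_n\}=\varnothing$ for $i\ne k$ and the set $\{x^i_j \mid 0\le i\le m,\ 1\le j\le n\}$ generates $X$. Let $(S,V)$ be an automorphic virtual multi-switch (AVMS) on $X$ with respect to the generating set $\{x^i_j \mid 0\le i\le m,\ 1\le j\le n\}$, with associated automorphisms $R_1,\dots,R_{n-1}$ and $G_1,\dots,G_{n-1}$ of $X$. Then the map $\varphi_{S,V}:VB_n\to \mathrm{Aut}(X)$ defined on the generators of the virtual braid group $VB_n$ by $$\varphi_{S,V}(\sigma_j)=R_j,\qquad \varphi_{S,V}(\rho_j)=G_j,\qquad j=1,2,\dots,n-1,$$ is a representation of $VB_n$ (i.e. it extends to a group homomorphism $VB_n\to \mathrm{Aut}(X)$).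
   Context: An algebraic system is a set with a family of algebraic operations (group, module, quandle, etc.). Composition: maps act on the right, $fg(x)=g(f(x))$; this is also the product in $\mathrm{Aut}(X)$. Virtual braid group: $VB_n$ has generators $\sigma_1,\dots,\sigma_{n-1},\rho_1,\dots,\rho_{n-1}$ and relations $\sigma_i\sigma_{i+1}\sigma_i=\sigma_{i+1}\sigma_i\sigma_{i+1}$, $\rho_i\rho_{i+1}\rho_i=\rho_{i+1}\rho_i\rho_{i+1}$, $\rho_{i+1}\sigma_i\rho_{i+1}=\rho_i\sigma_{i+1}\rho_i$ ($1\le i\le n-2$); $\sigma_i\sigma_j=\sigma_j\sigma_i$, $\rho_i\rho_j=\rho_j\rho_i$, $\sigma_i\rho_j=\rho_j\sigma_i$ ($|i-j|\ge 2$); $\rho_i^2=1$ ($1\le i\le n-1$). Switches: a switch on a set $Y$ is a bijection $S:Y\times Y\to Y\times Y$ with $(S\times id)(id\times S)(S\times id)=(id\times S)(S\times id)(id\times S)$ on $Y^3$. It is involutive if $S^2=id$. A virtual switch on $Y$ is a pair $(S,V)$ where $S$ is a switch, $V$ is an involutive switch, and $(id\times V)(S\times id)(id\times V)=(V\times id)(id\times S)(V\times id)$. Virtual multi-switch: let $X_1,\dots,X_m$ be non-empty subsets of $X$. Identify $(X\times X_1\times\dots\times X_m)^2$ with $X^2\times X_1^2\times\dots\times X_m^2$. An $(m+1)$-switch (multi-switch) on $X$ is a map $S$ of $X^2\times X_1^2\times\dots\times X_m^2$ to itself that is a switch on $X\times X_1\times\dots\times X_m$ and has the form $S(c_0,c_1,\dots,c_m)=(S_0(c_0,c_1,\dots,c_m),S_1(c_1),\dots,S_m(c_m))$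 for $c_0\in X^2$, $c_i\in X_i^2$, with maps $S_0:X^2\times X_1^2\times\dots\times X_m^2\to X^2$, $S_i:X_i^2\to X_i^2$ ($i\ge 1$). One writes $S=(S_0,\dots,S_m)$. The sets $X_i$ need not be subsystems. A virtual $(m+1)$-switch on $X$ is a pair $(S,V)$ of $(m+1)$-switches on $X$ (with the same $X_1,\dots,X_m$) which is a virtual switch on $X\times X_1\times\dots\times X_m$. AVMS: let $(S,V)$ be a virtual $(m+1)$-switch on $X$, $S=(S_0,\dots,S_m)$, $V=(V_0,\dots,V_m)$, and write $S_i=(S_i^l,S_i^r)$, $V_i=(V_i^l,V_i^r)$ for the two components. Assume each $S_i^l,S_i^r,V_i^l,V_i^r$ is given by a (fixed) word over its arguments in terms of the operations of $X$. For $j=1,\dots,n-1$ let $R_j:\{x^i_k\mid 0\le i\le m,\ 1\le k\le n\}\to X$ be given by $x^0_j\mapsto S_0^l(x^0_j,x^0_{j+1},x^1_j,x^1_{j+1},\dots,x^m_j,x^m_{j+1})$, $x^0_{j+1}\mapsto S_0^r(x^0_j,x^0_{j+1},x^1_j,x^1_{j+1},\dots,x^m_j,x^m_{j+1})$, $x^i_j\mapsto S_i^l(x^i_j,x^i_{j+1})$, $x^i_{j+1}\mapsto S_i^r(x^i_j,x^i_{j+1})$ for $i=1,\dots,m$, and $x^i_k\mapsto x^i_k$ for $k\notin\{j,j+1\}$, $0\le i\le m$. Let $G_j$ be defined by the same formulas with every $S_i^l,S_i^r$ replaced by $V_i^l,V_i^r$. For a fixed $i$ the elements $x^i_1,\dots,x^i_n$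 need not be distinct; it is assumed that all $R_j,G_j$ are well defined, i.e. equal elements have equal images. $(S,V)$ is called an automorphic virtual multi-switch (AVMS) on $X$ with respect to the generating set $\{x^i_j\}$ if all these assumptions hold and all $R_j,G_j$ ($1\le j\le n-1$) extend to automorphisms of $X$, again denoted $R_j,G_j$. *)

theory Defs
  imports "HOL-Algebra.Bij"
begin

section \<open>Algebraic systems, words and automorphisms\<close>

record ('a, 'f) alg_system = "'a partial_object" +
  ops :: "'f set"
  arity :: "'f \<Rightarrow> nat"
  interp :: "'f \<Rightarrow> 'a list \<Rightarrow> 'a"

definition op_args :: "('a, 'f, 'z) alg_system_scheme \<Rightarrow> 'f \<Rightarrow> 'a list set" where
  "op_args X f = {xs \<in> lists (carrier X). length xs = arity X f}"

definition alg_system :: "('a, 'f, 'z) alg_system_scheme \<Rightarrow> bool" where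
  "alg_system X \<longleftrightarrow> (\<forall>f\<in>ops X. \<forall>xs\<in>op_args X f. interp X f xs \<in> carrier X)"

inductive_set generated :: "('a, 'f, 'z) alg_system_scheme \<Rightarrow> 'a set \<Rightarrow> 'a set"
  for X and B where
  base: "b \<in> B \<Longrightarrow> b \<in> generated X B"
| step: "f \<in> ops X \<Longrightarrow> length xs = arity X f \<Longrightarrow> \<forall>x\<in>set xs. x \<in> generated X B
           \<Longrightarrow> interp X f xs \<in> generated X B"

datatype ('f, 'v) word = Var 'v | Op 'f "('f, 'v) word list"

inductive_set words :: "('a, 'f, 'z) alg_system_scheme \<Rightarrow> 'v set \<Rightarrow> ('f, 'v) word set"
  for X and W where
  Var: "v \<in> W \<Longrightarrow> Var v \<in> words X W"
| Op: "f \<in> ops X \<Longrightarrow> length ts = arity X f \<Longrightarrow> \<forall>t\<in>set ts. t \<in> words X W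
         \<Longrightarrow> Op f ts \<in> words X W"

primrec eval_word :: "('a, 'f, 'z) alg_system_scheme \<Rightarrow> ('v \<Rightarrow> 'a) \<Rightarrow> ('f, 'v) word \<Rightarrow> 'a" where
  "eval_word X e (Var v) = e v"
| "eval_word X e (Op f ts) = interp X f (map (eval_word X e) ts)"

definition automorphisms :: "('a, 'f, 'z) alg_system_scheme \<Rightarrow> ('a \<Rightarrow> 'a) set" where
  "automorphisms X = {h \<in> Bij (carrier X).
     \<forall>f\<in>ops X. \<forall>xs\<in>op_args X f. h (interp X f xs) = interp X f (map h xs)}"

text \<open>Maps act on the right: the product \<open>f g\<close> is the map sending \<open>x\<close> to \<open>g (f x)\<close>,
  in contrast to \<^const>\<open>BijGroup\<close>.\<close>

definition Aut :: "('a, 'f, 'z) alg_system_scheme \<Rightarrow> ('a \<Rightarrow> 'a) monoid" where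
  "Aut X = \<lparr>carrier = automorphisms X,
            mult = (\<lambda>f g. compose (carrier X) g f),
            one = (\<lambda>x\<in>carrier X. x)\<rparr>"


section \<open>Group presentations and the virtual braid group\<close>

text \<open>A group word is a list of letters; the letter \<open>(g, True)\<close> stands for the generator \<open>g\<close>
  and \<open>(g, False)\<close> for its inverse.\<close>

type_synonym 'g gword = "('g \<times> bool) list"

definition gwords :: "'g set \<Rightarrow> 'g gword set" where
  "gwords A = lists (A \<times> UNIV)"

inductive_set pres_eq :: "'g set \<Rightarrow> ('g gword \<times> 'g gword) set \<Rightarrow> ('g gword \<times> 'g gword) set"
  for A and Rel where
  refl: "u \<in> gwords A \<Longrightarrow> (u, u) \<in> pres_eq A Rel"
| sym: "(u, v) \<in> pres_eq A Rel \<Longrightarrow> (v, u) \<in> pres_eq A Rel"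
| trans: "(u, v) \<in> pres_eq A Rel \<Longrightarrow> (v, w) \<in> pres_eq A Rel \<Longrightarrow> (u, w) \<in> pres_eq A Rel"
| cancel: "u \<in> gwords A \<Longrightarrow> v \<in> gwords A \<Longrightarrow> g \<in> A
             \<Longrightarrow> (u @ [(g, b), (g, \<not> b)] @ v, u @ v) \<in> pres_eq A Rel"
| rel: "u \<in> gwords A \<Longrightarrow> v \<in> gwords A \<Longrightarrow> (l, r) \<in> Rel
          \<Longrightarrow> l \<in> gwords A \<Longrightarrow> r \<in> gwords A \<Longrightarrow> (u @ l @ v, u @ r @ v) \<in> pres_eq A Rel"

definition presented_group ::
    "'g set \<Rightarrow> ('g gword \<times> 'g gword) set \<Rightarrow> 'g gword set monoid" where
  "presented_group A Rel =
     \<lparr>carrier = gwords A // pres_eq A Rel,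
      mult = (\<lambda>P Q. \<Union>u\<in>P. \<Union>v\<in>Q. pres_eq A Rel `` {u @ v}),
      one = pres_eq A Rel `` {[]}\<rparr>"

definition pres_gen :: "'g set \<Rightarrow> ('g gword \<times> 'g gword) set \<Rightarrow> 'g \<Rightarrow> 'g gword set" where
  "pres_gen A Rel g = pres_eq A Rel `` {[(g, True)]}"

datatype vb_gen = Sigma nat | Rho nat

definition vb_gens :: "nat \<Rightarrow> vb_gen set" where
  "vb_gens n = Sigma ` {1..<n} \<union> Rho ` {1..<n}"

abbreviation pos_word :: "'g list \<Rightarrow> 'g gword" where
  "pos_word gs \<equiv> map (\<lambda>g. (g, True)) gs"

definition vb_rels :: "nat \<Rightarrow> (vb_gen gword \<times> vb_gen gword) set" where
  "vb_rels n =
     {(pos_word [Sigma i, Sigma (i+1), Sigma i], pos_word [Sigma (i+1), Sigma i, Sigma (i+1)])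
        | i. 1 \<le> i \<and> i + 2 \<le> n} \<union>
     {(pos_word [Rho i, Rho (i+1), Rho i], pos_word [Rho (i+1), Rho i, Rho (i+1)])
        | i. 1 \<le> i \<and> i + 2 \<le> n} \<union>
     {(pos_word [Rho (i+1), Sigma i, Rho (i+1)], pos_word [Rho i, Sigma (i+1), Rho i])
        | i. 1 \<le> i \<and> i + 2 \<le> n} \<union>
     {(pos_word [Sigma i, Sigma j], pos_word [Sigma j, Sigma i])
        | i j. i \<in> {1..<n} \<and> j \<in> {1..<n} \<and> (i + 2 \<le> j \<or> j + 2 \<le> i)} \<union>
     {(pos_word [Rho i, Rho j], pos_word [Rho j, Rho i])
        | i j. i \<in> {1..<n} \<and> j \<in> {1..<n} \<and> (i + 2 \<le> j \<or> j + 2 \<le> i)} \<union>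
     {(pos_word [Sigma i, Rho j], pos_word [Rho j, Sigma i])
        | i j. i \<in> {1..<n} \<and> j \<in> {1..<n} \<and> (i + 2 \<le> j \<or> j + 2 \<le> i)} \<union>
     {(pos_word [Rho i, Rho i], []) | i. i \<in> {1..<n}}"

definition VB :: "nat \<Rightarrow> vb_gen gword set monoid" where
  "VB n = presented_group (vb_gens n) (vb_rels n)"

definition vb_sigma :: "nat \<Rightarrow> nat \<Rightarrow> vb_gen gword set" where
  "vb_sigma n j = pres_gen (vb_gens n) (vb_rels n) (Sigma j)"

definition vb_rho :: "nat \<Rightarrow> nat \<Rightarrow> vb_gen gword set" where
  "vb_rho n j = pres_gen (vb_gens n) (vb_rels n) (Rho j)"


section \<open>Switches and virtual switches\<close>

definition on12 :: "('y \<times> 'y \<Rightarrow> 'y \<times> 'y) \<Rightarrow> 'y \<times> 'y \<times> 'y \<Rightarrow> 'y \<times> 'y \<times> 'y" where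
  "on12 S = (\<lambda>(a, b, c). case S (a, b) of (a', b') \<Rightarrow> (a', b', c))"

definition on23 :: "('y \<times> 'y \<Rightarrow> 'y \<times> 'y) \<Rightarrow> 'y \<times> 'y \<times> 'y \<Rightarrow> 'y \<times> 'y \<times> 'y" where
  "on23 S = (\<lambda>(a, b, c). case S (b, c) of (b', c') \<Rightarrow> (a, b', c'))"

definition switch :: "'y set \<Rightarrow> ('y \<times> 'y \<Rightarrow> 'y \<times> 'y) \<Rightarrow> bool" where
  "switch Y S \<longleftrightarrow> bij_betw S (Y \<times> Y) (Y \<times> Y) \<and>
     (\<forall>t\<in>Y \<times> Y \<times> Y. on12 S (on23 S (on12 S t)) = on23 S (on12 S (on23 S t)))"

definition involutive :: "'y set \<Rightarrow> ('y \<times> 'y \<Rightarrow> 'y \<times> 'y) \<Rightarrow> bool" where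
  "involutive Y S \<longleftrightarrow> (\<forall>p\<in>Y \<times> Y. S (S p) = p)"

definition virtual_switch ::
    "'y set \<Rightarrow> ('y \<times> 'y \<Rightarrow> 'y \<times> 'y) \<Rightarrow> ('y \<times> 'y \<Rightarrow> 'y \<times> 'y) \<Rightarrow> bool" where
  "virtual_switch Y S V \<longleftrightarrow> switch Y S \<and> switch Y V \<and> involutive Y V \<and>
     (\<forall>t\<in>Y \<times> Y \<times> Y. on23 V (on12 S (on23 V t)) = on12 V (on23 S (on12 V t)))"


section \<open>Multi-switches\<close>

text \<open>The components \<open>S\<^sub>0\<close> and \<open>S\<^sub>1, S\<^sub>2, \<dots>\<close> of a multi-switch. The argument
  \<open>(c\<^sub>0, \<dots>, c\<^sub>m)\<close> of \<open>S\<^sub>0\<close> is the extensional function \<open>i \<mapsto> c\<^sub>i\<close> on \<open>{..m}\<close>.\<close>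

record 'a multi_switch_data =
  ms_zero :: "(nat \<Rightarrow> 'a \<times> 'a) \<Rightarrow> 'a \<times> 'a"
  ms_comp :: "nat \<Rightarrow> 'a \<times> 'a \<Rightarrow> 'a \<times> 'a"

text \<open>The factors of \<open>A \<times> X\<^sub>1 \<times> \<dots> \<times> X\<^sub>m\<close>: the zeroth one is the whole set \<open>A\<close>, so the
  value \<open>Xs 0\<close> plays no role here.\<close>

definition factor :: "'a set \<Rightarrow> (nat \<Rightarrow> 'a set) \<Rightarrow> nat \<Rightarrow> 'a set" where
  "factor A Xs i = (if i = 0 then A else Xs i)"

definition tuples :: "nat \<Rightarrow> 'a set \<Rightarrow> (nat \<Rightarrow> 'a set) \<Rightarrow> (nat \<Rightarrow> 'a) set" where
  "tuples m A Xs = (\<Pi>\<^sub>E i\<in>{..m}. factor A Xs i)"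

definition pair_tuples :: "nat \<Rightarrow> 'a set \<Rightarrow> (nat \<Rightarrow> 'a set) \<Rightarrow> (nat \<Rightarrow> 'a \<times> 'a) set" where
  "pair_tuples m A Xs = (\<Pi>\<^sub>E i\<in>{..m}. factor A Xs i \<times> factor A Xs i)"

definition ms_map :: "nat \<Rightarrow> 'a multi_switch_data \<Rightarrow> (nat \<Rightarrow> 'a \<times> 'a) \<Rightarrow> (nat \<Rightarrow> 'a \<times> 'a)" where
  "ms_map m S c = (\<lambda>i\<in>{..m}. if i = 0 then ms_zero S c else ms_comp S i (c i))"

text \<open>The same map after identifying \<open>A\<^sup>2 \<times> X\<^sub>1\<^sup>2 \<times> \<dots> \<times> X\<^sub>m\<^sup>2\<close> with the square of
  \<open>A \<times> X\<^sub>1 \<times> \<dots> \<times> X\<^sub>m\<close>.\<close>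

definition zip_tuple :: "nat \<Rightarrow> (nat \<Rightarrow> 'a) \<times> (nat \<Rightarrow> 'a) \<Rightarrow> (nat \<Rightarrow> 'a \<times> 'a)" where
  "zip_tuple m p = (\<lambda>i\<in>{..m}. (fst p i, snd p i))"

definition unzip_tuple :: "nat \<Rightarrow> (nat \<Rightarrow> 'a \<times> 'a) \<Rightarrow> (nat \<Rightarrow> 'a) \<times> (nat \<Rightarrow> 'a)" where
  "unzip_tuple m c = (\<lambda>i\<in>{..m}. fst (c i), \<lambda>i\<in>{..m}. snd (c i))"

definition ms_switch ::
    "nat \<Rightarrow> 'a multi_switch_data \<Rightarrow> (nat \<Rightarrow> 'a) \<times> (nat \<Rightarrow> 'a) \<Rightarrow> (nat \<Rightarrow> 'a) \<times> (nat \<Rightarrow> 'a)" where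
  "ms_switch m S p = unzip_tuple m (ms_map m S (zip_tuple m p))"

definition multi_switch ::
    "nat \<Rightarrow> 'a set \<Rightarrow> (nat \<Rightarrow> 'a set) \<Rightarrow> 'a multi_switch_data \<Rightarrow> bool" where
  "multi_switch m A Xs S \<longleftrightarrow>
     (\<forall>i\<in>{1..m}. Xs i \<noteq> {} \<and> Xs i \<subseteq> A) \<and>
     ms_zero S \<in> pair_tuples m A Xs \<rightarrow> A \<times> A \<and>
     (\<forall>i\<in>{1..m}. ms_comp S i \<in> Xs i \<times> Xs i \<rightarrow> Xs i \<times> Xs i) \<and>
     switch (tuples m A Xs) (ms_switch m S)"

definition virtual_multi_switch ::
    "nat \<Rightarrow> 'a set \<Rightarrow> (nat \<Rightarrow> 'a set) \<Rightarrow> 'a multi_switch_data \<Rightarrow> 'a multi_switch_data \<Rightarrow> bool" where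
  "virtual_multi_switch m A Xs S V \<longleftrightarrow>
     multi_switch m A Xs S \<and> multi_switch m A Xs V \<and>
     virtual_switch (tuples m A Xs) (ms_switch m S) (ms_switch m V)"


section \<open>Automorphic virtual multi-switches\<close>

datatype side = Lft | Rgt

fun proj :: "side \<Rightarrow> 'a \<times> 'a \<Rightarrow> 'a" where
  "proj Lft p = fst p"
| "proj Rgt p = snd p"

text \<open>All components are given by words: the variable \<open>(i, Lft)\<close> or \<open>(i, Rgt)\<close> of a word for
  \<open>S\<^sub>0\<^sup>l\<close> or \<open>S\<^sub>0\<^sup>r\<close> stands for the left or right entry of \<open>c\<^sub>i\<close>.\<close>

definition given_by_words ::
    "nat \<Rightarrow> ('a, 'f, 'z) alg_system_scheme \<Rightarrow> (nat \<Rightarrow> 'a set) \<Rightarrow> 'a multi_switch_data \<Rightarrow> bool" where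
  "given_by_words m X Xs S \<longleftrightarrow>
     (\<forall>s. \<exists>w\<in>words X ({..m} \<times> UNIV). \<forall>c\<in>pair_tuples m (carrier X) Xs.
        proj s (ms_zero S c) = eval_word X (\<lambda>(i, t). proj t (c i)) w) \<and>
     (\<forall>i\<in>{1..m}. \<forall>s. \<exists>w\<in>words X UNIV. \<forall>p\<in>Xs i \<times> Xs i.
        proj s (ms_comp S i p) = eval_word X (\<lambda>t. proj t p) w)"

text \<open>\<open>gen_image m S x j i k\<close> is the image of the generator \<open>x i k\<close> under the map
  with index \<open>j\<close> induced by the components of \<open>S\<close>.\<close>

definition gen_image ::
    "nat \<Rightarrow> 'a multi_switch_data \<Rightarrow> (nat \<Rightarrow> nat \<Rightarrow> 'a) \<Rightarrow> nat \<Rightarrow> nat \<Rightarrow> nat \<Rightarrow> 'a" where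
  "gen_image m S x j i k =
     (let c = (\<lambda>i\<in>{..m}. (x i j, x i (j+1)))
      in if k = j then fst (ms_map m S c i)
         else if k = j+1 then snd (ms_map m S c i)
         else x i k)"

definition gen_map_well_defined ::
    "nat \<Rightarrow> nat \<Rightarrow> (nat \<Rightarrow> nat \<Rightarrow> 'a) \<Rightarrow> 'a multi_switch_data \<Rightarrow> nat \<Rightarrow> bool" where
  "gen_map_well_defined n m x S j \<longleftrightarrow>
     (\<forall>i\<in>{..m}. \<forall>k\<in>{1..n}. \<forall>i'\<in>{..m}. \<forall>k'\<in>{1..n}.
        x i k = x i' k' \<longrightarrow> gen_image m S x j i k = gen_image m S x j i' k')"

definition extends_gen_map ::
    "nat \<Rightarrow> nat \<Rightarrow> (nat \<Rightarrow> nat \<Rightarrow> 'a) \<Rightarrow> 'a multi_switch_data \<Rightarrow> nat \<Rightarrow> ('a \<Rightarrow> 'a) \<Rightarrow> bool" where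
  "extends_gen_map n m x S j h \<longleftrightarrow> (\<forall>i\<in>{..m}. \<forall>k\<in>{1..n}. h (x i k) = gen_image m S x j i k)"

definition AVMS ::
    "nat \<Rightarrow> nat \<Rightarrow> ('a, 'f, 'z) alg_system_scheme \<Rightarrow> (nat \<Rightarrow> 'a set) \<Rightarrow> (nat \<Rightarrow> nat \<Rightarrow> 'a)
     \<Rightarrow> 'a multi_switch_data \<Rightarrow> 'a multi_switch_data \<Rightarrow> bool" where
  "AVMS n m X Xs x S V \<longleftrightarrow>
     virtual_multi_switch m (carrier X) Xs S V \<and>
     given_by_words m X Xs S \<and> given_by_words m X Xs V \<and>
     (\<forall>j\<in>{1..<n}.
        gen_map_well_defined n m x S j \<and> gen_map_well_defined n m x V j \<and>
        (\<exists>h\<in>carrier (Aut X). extends_gen_map n m x S j h) \<and>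
        (\<exists>h\<in>carrier (Aut X). extends_gen_map n m x V j h))"

end

theory Submission
  imports Defs
begin

text \<open>Write \<open>Y\<close> for the set of tuples \<open>X \<times> X\<^sub>1 \<times> \<dots> \<times> X\<^sub>m\<close>. The switches \<open>S\<close> and \<open>V\<close> act on
  \<open>Y\<^sup>n\<close> through neighbouring coordinates, and the axioms of a virtual switch say that these maps
  satisfy the defining relations of \<open>VB\<^sub>n\<close>. Since the components are words, an automorphism \<open>h\<close>
  commutes with this action on every point \<open>z\<close> such that \<open>z\<close> and \<open>h z\<close> both lie in \<open>Y\<^sup>n\<close>.
  Hence a product of the given automorphisms sends the point \<open>x\<close> of generators to the image of \<open>x\<close>
  under the corresponding composition of local maps. Both sides of a relation therefore agree on
  the generators of \<open>X\<close>, so they agree on \<open>X\<close>.\<close>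

section \<open>Presented groups\<close>

lemma gwords_append [simp]: "u @ v \<in> gwords A \<longleftrightarrow> u \<in> gwords A \<and> v \<in> gwords A"
  by (auto simp: gwords_def)

lemma gwords_Nil [simp]: "[] \<in> gwords A"
  by (simp add: gwords_def)

lemma gwords_Cons [simp]: "(g, b) # u \<in> gwords A \<longleftrightarrow> g \<in> A \<and> u \<in> gwords A"
  by (auto simp: gwords_def)

lemma pres_eq_gwords:
  assumes "(u, v) \<in> pres_eq A Rel"
  shows "u \<in> gwords A \<and> v \<in> gwords A"
  using assms by (induction rule: pres_eq.induct) auto

lemma equiv_pres_eq: "equiv (gwords A) (pres_eq A Rel)"
proof (rule equivI)
  show "pres_eq A Rel \<subseteq> gwords A \<times> gwords A"
    by (auto dest: pres_eq_gwords)
  show "refl_on (gwords A) (pres_eq A Rel)"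
    by (auto intro: refl_onI pres_eq.refl)
  show "sym (pres_eq A Rel)"
    by (auto intro: symI pres_eq.sym)
  show "trans (pres_eq A Rel)"
    by (auto intro: transI pres_eq.trans)
qed

text \<open>The rules \<open>cancel\<close> and \<open>rel\<close> already carry a left and a right
  context, which absorb \<open>a\<close> and \<open>b\<close>. This is what makes the relation a
  congruence.\<close>

lemma pres_eq_context:
  assumes "(u, v) \<in> pres_eq A Rel" "a \<in> gwords A" "b \<in> gwords A"
  shows "(a @ u @ b, a @ v @ b) \<in> pres_eq A Rel"
  using assms
proof (induction rule: pres_eq.induct)
  case (cancel u v g c)
  then show ?case
    using pres_eq.cancel[of "a @ u" A "v @ b" g c Rel] by simp
next
  case (rel u v l r)
  then show ?case
    using pres_eq.rel[of "a @ u" A "v @ b" l r Rel] by simp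
qed (auto intro: pres_eq.intros)

lemma pres_eq_append:
  assumes "(u, u') \<in> pres_eq A Rel" "(v, v') \<in> pres_eq A Rel"
  shows "(u @ v, u' @ v') \<in> pres_eq A Rel"
proof -
  have "(u @ v, u' @ v) \<in> pres_eq A Rel"
    using pres_eq_context[OF assms(1), of "[]" v] pres_eq_gwords[OF assms(2)] by simp
  moreover have "(u' @ v, u' @ v') \<in> pres_eq A Rel"
    using pres_eq_context[OF assms(2), of u' "[]"] pres_eq_gwords[OF assms(1)] by simp
  ultimately show ?thesis
    by (rule pres_eq.trans)
qed

lemma pres_class_eq_iff:
  assumes "u \<in> gwords A" "v \<in> gwords A"
  shows "pres_eq A Rel `` {u} = pres_eq A Rel `` {v} \<longleftrightarrow> (u, v) \<in> pres_eq A Rel"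
  using eq_equiv_class_iff[OF equiv_pres_eq assms] .

text \<open>The product of classes is a union over all representatives. By
  \<open>pres_eq_append\<close> all classes in that union coincide, and reflexivity keeps the union
  from being empty.\<close>

lemma presented_group_mult:
  assumes "u \<in> gwords A" "v \<in> gwords A"
  shows "pres_eq A Rel `` {u} \<otimes>\<^bsub>presented_group A Rel\<^esub> pres_eq A Rel `` {v} =
    pres_eq A Rel `` {u @ v}"
proof -
  have "(\<Union>u'\<in>pres_eq A Rel `` {u}. \<Union>v'\<in>pres_eq A Rel `` {v}. pres_eq A Rel `` {u' @ v'}) =
      pres_eq A Rel `` {u @ v}" (is "?L = ?R")
  proof -
    have "pres_eq A Rel `` {u' @ v'} = ?R"
      if "(u, u') \<in> pres_eq A Rel" "(v, v') \<in> pres_eq A Rel" for u' v'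
      using equiv_class_eq[OF equiv_pres_eq pres_eq_append[OF that]] by simp
    moreover have "(u, u) \<in> pres_eq A Rel" "(v, v) \<in> pres_eq A Rel"
      using assms by (auto intro: pres_eq.refl)
    ultimately show ?thesis
      by blast
  qed
  then show ?thesis
    by (simp add: presented_group_def)
qed

lemma presented_group_carrierE:
  assumes "P \<in> carrier (presented_group A Rel)"
  obtains u where "u \<in> gwords A" "P = pres_eq A Rel `` {u}"
  using assms by (auto simp: presented_group_def elim: quotientE)

lemma presented_group_carrierI:
  "u \<in> gwords A \<Longrightarrow> pres_eq A Rel `` {u} \<in> carrier (presented_group A Rel)"
  by (simp add: presented_group_def quotientI)

definition gword_inv :: "'g gword \<Rightarrow> 'g gword" where
  "gword_inv u = rev (map (\<lambda>(g, b). (g, \<not> b)) u)"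

lemma gword_inv_gwords: "u \<in> gwords A \<Longrightarrow> gword_inv u \<in> gwords A"
  by (induction u) (auto simp: gword_inv_def)

lemma gword_inv_cancel: "u \<in> gwords A \<Longrightarrow> (gword_inv u @ u, []) \<in> pres_eq A Rel"
proof (induction u)
  case Nil
  then show ?case by (simp add: gword_inv_def pres_eq.refl)
next
  case (Cons a u)
  obtain g b where a: "a = (g, b)" by fastforce
  with Cons.prems have "g \<in> A" "u \<in> gwords A" by auto
  \<comment> \<open>The innermost pair of \<open>gword_inv (a # u) @ a # u\<close> is cancelled
    first. Its left letter carries the sign \<open>\<not> b\<close>, so the rule yields a double
    negation on the right.\<close>
  then have "(gword_inv u @ [(g, \<not> b), (g, \<not> \<not> b)] @ u, gword_inv u @ u) \<in> pres_eq A Rel"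
    by (intro pres_eq.cancel gword_inv_gwords)
  moreover have "(gword_inv u @ u, []) \<in> pres_eq A Rel"
    using Cons.IH \<open>u \<in> gwords A\<close> .
  ultimately have "(gword_inv u @ [(g, \<not> b), (g, b)] @ u, []) \<in> pres_eq A Rel"
    by (auto intro: pres_eq.trans)
  then show ?case by (simp add: a gword_inv_def)
qed

lemma group_presented_group: "group (presented_group A Rel)"
proof (rule groupI)
  have one: "\<one>\<^bsub>presented_group A Rel\<^esub> = pres_eq A Rel `` {[]}"
    by (simp add: presented_group_def)
  show "\<one>\<^bsub>presented_group A Rel\<^esub> \<in> carrier (presented_group A Rel)"
    by (simp add: one presented_group_carrierI)
  fix P assume "P \<in> carrier (presented_group A Rel)"
  then obtain u where u: "u \<in> gwords A" "P = pres_eq A Rel `` {u}"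
    by (rule presented_group_carrierE)
  show "\<one>\<^bsub>presented_group A Rel\<^esub> \<otimes>\<^bsub>presented_group A Rel\<^esub> P = P"
    by (simp add: one u presented_group_mult)
  show "\<exists>Q\<in>carrier (presented_group A Rel).
      Q \<otimes>\<^bsub>presented_group A Rel\<^esub> P = \<one>\<^bsub>presented_group A Rel\<^esub>"
  proof (intro bexI)
    show "pres_eq A Rel `` {gword_inv u} \<otimes>\<^bsub>presented_group A Rel\<^esub> P = \<one>\<^bsub>presented_group A Rel\<^esub>"
      using u gword_inv_cancel[of u A Rel]
      by (simp add: one presented_group_mult gword_inv_gwords pres_class_eq_iff)
  qed (simp add: presented_group_carrierI gword_inv_gwords u)
  fix Q assume "Q \<in> carrier (presented_group A Rel)"
  then obtain v where v: "v \<in> gwords A" "Q = pres_eq A Rel `` {v}"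
    by (rule presented_group_carrierE)
  show "P \<otimes>\<^bsub>presented_group A Rel\<^esub> Q \<in> carrier (presented_group A Rel)"
    by (simp add: u v presented_group_mult presented_group_carrierI)
  fix T assume "T \<in> carrier (presented_group A Rel)"
  then obtain w where w: "w \<in> gwords A" "T = pres_eq A Rel `` {w}"
    by (rule presented_group_carrierE)
  show "P \<otimes>\<^bsub>presented_group A Rel\<^esub> Q \<otimes>\<^bsub>presented_group A Rel\<^esub> T =
      P \<otimes>\<^bsub>presented_group A Rel\<^esub> (Q \<otimes>\<^bsub>presented_group A Rel\<^esub> T)"
    by (simp add: u v w presented_group_mult)
qed

text \<open>Letters are multiplied from left to right, so in \<open>Aut X\<close> the first letter
  is the map that acts first.\<close>

definition gword_eval :: "('b, 'z) monoid_scheme \<Rightarrow> ('g \<Rightarrow> 'b) \<Rightarrow> 'g gword \<Rightarrow> 'b" where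
  "gword_eval H f u = foldr (\<lambda>(g, b) a. (if b then f g else inv\<^bsub>H\<^esub> f g) \<otimes>\<^bsub>H\<^esub> a) u \<one>\<^bsub>H\<^esub>"

lemma gword_eval_simps [simp]:
  "gword_eval H f [] = \<one>\<^bsub>H\<^esub>"
  "gword_eval H f ((g, b) # u) = (if b then f g else inv\<^bsub>H\<^esub> f g) \<otimes>\<^bsub>H\<^esub> gword_eval H f u"
  by (simp_all add: gword_eval_def)

context
  fixes H :: "('b, 'z) monoid_scheme" (structure) and A :: "'g set" and f :: "'g \<Rightarrow> 'b"
  assumes H: "group H" and f: "f \<in> A \<rightarrow> carrier H"
begin

interpretation group H by (fact H)

lemma gen_closed: "g \<in> A \<Longrightarrow> f g \<in> carrier H"
  using f by (rule funcset_mem)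

lemma gword_eval_closed: "u \<in> gwords A \<Longrightarrow> gword_eval H f u \<in> carrier H"
  by (induction u) (auto simp: gen_closed)

lemma gword_eval_append:
  "u \<in> gwords A \<Longrightarrow> v \<in> gwords A \<Longrightarrow>
    gword_eval H f (u @ v) = gword_eval H f u \<otimes> gword_eval H f v"
proof (induction u)
  case Nil
  then show ?case by (simp add: gword_eval_closed)
next
  case (Cons a u)
  obtain g b where "a = (g, b)" by fastforce
  then show ?case
    using Cons by (auto simp: m_assoc gword_eval_closed gen_closed)
qed

text \<open>Having equal values is an equivalence relation that is compatible with concatenation. It
  contains the cancellations by the inverse laws and the relations by \<open>rels\<close>, and these
  generate \<open>pres_eq\<close>.\<close>

lemma gword_eval_pres_eq:
  assumes "(u, v) \<in> pres_eq A Rel"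
    and rels: "\<And>l r. (l, r) \<in> Rel \<Longrightarrow> l \<in> gwords A \<Longrightarrow> r \<in> gwords A \<Longrightarrow>
      gword_eval H f l = gword_eval H f r"
  shows "gword_eval H f u = gword_eval H f v"
  using assms(1)
proof (induction rule: pres_eq.induct)
  case (cancel u v g b)
  then have "f g \<in> carrier H" by (simp add: gen_closed)
  then have "gword_eval H f ([(g, b), (g, \<not> b)] @ v) = gword_eval H f v"
    using cancel by (cases b) (simp_all add: gword_eval_closed m_assoc[symmetric])
  then show ?case
    using cancel by (simp add: gword_eval_append del: gword_eval_simps)
next
  case (rel u v l r)
  then show ?case
    using rels[of l r] by (simp add: gword_eval_append)
qed auto

text \<open>This is von Dyck's theorem. It reduces the construction of a representation to checking
  the defining relations in the target group.\<close>

lemma presented_group_hom_exists: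
  assumes rels: "\<And>l r. (l, r) \<in> Rel \<Longrightarrow> l \<in> gwords A \<Longrightarrow> r \<in> gwords A \<Longrightarrow>
      gword_eval H f l = gword_eval H f r"
  shows "\<exists>\<phi>. group_hom (presented_group A Rel) H \<phi> \<and> (\<forall>g\<in>A. \<phi> (pres_gen A Rel g) = f g)"
proof -
  \<comment> \<open>A class is evaluated at a chosen representative; by
    \<open>gword_eval_pres_eq\<close> the value does not depend on the choice.\<close>
  define \<phi> where "\<phi> P = gword_eval H f (SOME u. u \<in> P)" for P
  have \<phi>: "\<phi> (pres_eq A Rel `` {u}) = gword_eval H f u" if "u \<in> gwords A" for u
  proof -
    have "u \<in> pres_eq A Rel `` {u}"
      using that by (auto intro: pres_eq.refl)
    then have "(SOME v. v \<in> pres_eq A Rel `` {u}) \<in> pres_eq A Rel `` {u}"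
      by (rule someI)
    then have "(u, SOME v. v \<in> pres_eq A Rel `` {u}) \<in> pres_eq A Rel"
      by simp
    from gword_eval_pres_eq[OF this rels] show ?thesis
      by (simp add: \<phi>_def)
  qed
  have "\<phi> \<in> hom (presented_group A Rel) H"
    by (rule homI)
      (auto elim!: presented_group_carrierE
        simp: \<phi> presented_group_mult gword_eval_closed gword_eval_append)
  moreover have "\<phi> (pres_gen A Rel g) = f g" if "g \<in> A" for g
    using that by (simp add: pres_gen_def \<phi> gen_closed)
  ultimately show ?thesis
    using group_presented_group H
    by (auto simp: group_hom_def group_hom_axioms_def)
qed

end

section \<open>Automorphisms and words\<close>

lemma automorphisms_closed: "h \<in> automorphisms X \<Longrightarrow> a \<in> carrier X \<Longrightarrow> h a \<in> carrier X"
  by (auto simp: automorphisms_def Bij_def bij_betw_def)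

lemma automorphisms_interp:
  assumes "h \<in> automorphisms X" "f \<in> ops X" "set xs \<subseteq> carrier X" "length xs = arity X f"
  shows "h (interp X f xs) = interp X f (map h xs)"
  using assms by (auto simp: automorphisms_def op_args_def)

lemma alg_system_interp_closed:
  assumes "alg_system X" "f \<in> ops X" "set xs \<subseteq> carrier X" "length xs = arity X f"
  shows "interp X f xs \<in> carrier X"
  using assms by (auto simp: alg_system_def op_args_def)

lemma automorphismsI:
  assumes "h \<in> Bij (carrier X)"
    and "\<And>f xs. f \<in> ops X \<Longrightarrow> set xs \<subseteq> carrier X \<Longrightarrow> length xs = arity X f \<Longrightarrow>
      h (interp X f xs) = interp X f (map h xs)"
  shows "h \<in> automorphisms X"
  using assms by (auto simp: automorphisms_def op_args_def)

lemma group_Aut: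
  assumes X: "alg_system X"
  shows "group (Aut X)"
proof (rule groupI)
  show "\<one>\<^bsub>Aut X\<^esub> \<in> carrier (Aut X)"
    unfolding Aut_def monoid.simps partial_object.simps
  proof (rule automorphismsI)
    fix f xs assume "f \<in> ops X" "set xs \<subseteq> carrier X" "length xs = arity X f"
    moreover from this(2) have "map (\<lambda>a\<in>carrier X. a) xs = xs"
      by (intro map_idI) auto
    ultimately show "(\<lambda>a\<in>carrier X. a) (interp X f xs) = interp X f (map (\<lambda>a\<in>carrier X. a) xs)"
      using alg_system_interp_closed[OF X] by simp
  qed (rule id_Bij)
  fix g assume "g \<in> carrier (Aut X)"
  then have g: "g \<in> automorphisms X" "g \<in> Bij (carrier X)"
    by (auto simp: Aut_def automorphisms_def)
  then have bij: "bij_betw g (carrier X) (carrier X)" and ext: "g \<in> extensional (carrier X)"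
    by (auto simp: Bij_def)
  show "\<one>\<^bsub>Aut X\<^esub> \<otimes>\<^bsub>Aut X\<^esub> g = g"
    using ext by (auto simp: Aut_def compose_def extensional_def)
  \<comment> \<open>Elements of \<open>Bij\<close> are extensional, so the inverse has to be
    restricted to the carrier.\<close>
  let ?k = "\<lambda>a\<in>carrier X. inv_into (carrier X) g a"
  have kg: "?k (g a) = a" if "a \<in> carrier X" for a
    using that bij automorphisms_closed[OF g(1) that]
    by (simp add: bij_betw_def inv_into_f_f)
  have gk: "g (?k a) = a" and kc: "?k a \<in> carrier X" if "a \<in> carrier X" for a
    using that bij by (auto simp: bij_betw_def f_inv_into_f intro: inv_into_into)
  have "?k \<in> automorphisms X"
  proof (rule automorphismsI)
    show "?k \<in> Bij (carrier X)"
      using g(2) by (rule restrict_inv_into_Bij)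
    fix f xs assume f: "f \<in> ops X" "set xs \<subseteq> carrier X" "length xs = arity X f"
    \<comment> \<open>The arguments are pulled back along \<open>g\<close>. Since \<open>g\<close>
      sends \<open>interp X f ?ys\<close> to \<open>interp X f xs\<close>, applying
      \<open>?k\<close> to the latter recovers the former.\<close>
    let ?ys = "map ?k xs"
    have ys: "set ?ys \<subseteq> carrier X" "length ?ys = arity X f"
      using f kc by auto
    have "map g ?ys = xs"
      unfolding map_map by (rule map_idI) (use f gk in auto)
    then have "g (interp X f ?ys) = interp X f xs"
      using automorphisms_interp[OF g(1) f(1) ys] by simp
    then show "?k (interp X f xs) = interp X f ?ys"
      using kg[OF alg_system_interp_closed[OF X f(1) ys]] by simp
  qed
  \<comment> \<open>The left factor of a product acts first, so the left inverse law is
    \<open>gk\<close> and not \<open>kg\<close>.\<close>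
  then show "\<exists>k\<in>carrier (Aut X). k \<otimes>\<^bsub>Aut X\<^esub> g = \<one>\<^bsub>Aut X\<^esub>"
    by (intro bexI[of _ ?k]) (use gk in \<open>auto simp: Aut_def compose_def\<close>)
  fix h assume "h \<in> carrier (Aut X)"
  then have h: "h \<in> automorphisms X" "h \<in> Bij (carrier X)"
    by (auto simp: Aut_def automorphisms_def)
  show "g \<otimes>\<^bsub>Aut X\<^esub> h \<in> carrier (Aut X)"
    unfolding Aut_def monoid.simps partial_object.simps
  proof (rule automorphismsI)
    fix f xs assume f: "f \<in> ops X" "set xs \<subseteq> carrier X" "length xs = arity X f"
    have map: "map h (map g xs) = map (compose (carrier X) h g) xs"
      using f(2) by (auto simp: compose_def)
    have gxs: "set (map g xs) \<subseteq> carrier X" "length (map g xs) = arity X f"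
      using f automorphisms_closed[OF g(1)] by auto
    show "compose (carrier X) h g (interp X f xs) = interp X f (map (compose (carrier X) h g) xs)"
      using automorphisms_interp[OF g(1) f] automorphisms_interp[OF h(1) f(1) gxs]
      by (simp only: compose_eq[OF alg_system_interp_closed[OF X f]] map)
  qed (rule compose_Bij[OF h(2) g(2)])
  fix k assume "k \<in> carrier (Aut X)"
  show "g \<otimes>\<^bsub>Aut X\<^esub> h \<otimes>\<^bsub>Aut X\<^esub> k = g \<otimes>\<^bsub>Aut X\<^esub> (h \<otimes>\<^bsub>Aut X\<^esub> k)"
    using automorphisms_closed[OF g(1)] by (auto simp: Aut_def compose_def)
qed

text \<open>Closure and equivariance go through one induction: \<open>h\<close> is known to commute
  with an operation only on arguments in the carrier, so the values of the subwords must be known to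
  lie there.\<close>

lemma automorphisms_eval_word:
  assumes X: "alg_system X" and h: "h \<in> automorphisms X"
    and w: "w \<in> words X W" and e: "e \<in> W \<rightarrow> carrier X"
    and e': "\<And>v. v \<in> W \<Longrightarrow> e' v = h (e v)"
  shows "eval_word X e w \<in> carrier X \<and> h (eval_word X e w) = eval_word X e' w"
  using w
proof (induction rule: words.induct)
  case (Var v)
  then show ?case using e e' by auto
next
  case (Op f ts)
  let ?xs = "map (eval_word X e) ts"
  have xs: "set ?xs \<subseteq> carrier X" "length ?xs = arity X f"
    using Op by auto
  have "map h ?xs = map (eval_word X e') ts"
    using Op by auto
  then have "h (interp X f ?xs) = interp X f (map (eval_word X e') ts)"
    using automorphisms_interp[OF h \<open>f \<in> ops X\<close> xs] by (simp only:)
  then show ?case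
    using alg_system_interp_closed[OF X \<open>f \<in> ops X\<close> xs] by simp
qed

text \<open>The points where \<open>g\<close> and \<open>h\<close> agree are closed under the
  operations. Outside the carrier both maps are \<open>undefined\<close>, so agreement on the
  carrier gives equality of functions.\<close>

lemma automorphisms_eqI:
  assumes g: "g \<in> automorphisms X" and h: "h \<in> automorphisms X"
    and B: "B \<subseteq> carrier X" and gen: "generated X B = carrier X"
    and eq: "\<And>b. b \<in> B \<Longrightarrow> g b = h b"
  shows "g = h"
proof -
  have "g a = h a" if "a \<in> generated X B" for a
    using that
  proof (induction rule: generated.induct)
    case (step f xs)
    then have "set xs \<subseteq> carrier X" and "map g xs = map h xs"
      using gen by auto
    then show ?case
      using step automorphisms_interp[OF g] automorphisms_interp[OF h] by metis
  qed (use eq in auto)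
  then have "g a = h a" if "a \<in> carrier X" for a
    using that gen by simp
  moreover have "g \<in> extensional (carrier X)" "h \<in> extensional (carrier X)"
    using g h by (auto simp: automorphisms_def Bij_def)
  ultimately show ?thesis
    by (intro extensionalityI)
qed

section \<open>Local action of a switch\<close>

text \<open>On n-tuples this is id x ... x s x ... x id, with \<open>s\<close> in the positions
  \<open>j\<close> and \<open>j + 1\<close>.\<close>

definition local_act :: "('y \<times> 'y \<Rightarrow> 'y \<times> 'y) \<Rightarrow> nat \<Rightarrow> (nat \<Rightarrow> 'y) \<Rightarrow> nat \<Rightarrow> 'y" where
  "local_act s j z =
     z(j := fst (s (z j, z (Suc j))), Suc j := snd (s (z j, z (Suc j))))"

definition put3 :: "nat \<Rightarrow> (nat \<Rightarrow> 'y) \<Rightarrow> 'y \<times> 'y \<times> 'y \<Rightarrow> nat \<Rightarrow> 'y" where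
  "put3 j z = (\<lambda>(a, b, c). z(j := a, Suc j := b, Suc (Suc j) := c))"

text \<open>Transfers identities between maps of triples to identities between local maps at
  neighbouring positions.\<close>

lemma local_act_put3:
  "local_act s j (put3 j z p) = put3 j z (on12 s p)"
  "local_act s (Suc j) (put3 j z p) = put3 j z (on23 s p)"
  by (cases p; auto simp: local_act_def put3_def on12_def on23_def fun_eq_iff split: prod.splits)+

lemma put3_self: "put3 j z (z j, z (Suc j), z (Suc (Suc j))) = z"
  by (auto simp: put3_def)

text \<open>Six independent maps cover the braid relations of both switches and the mixed relation
  at once. The identity is required only at the triple found in \<open>z\<close>, because a switch
  satisfies its axioms only on its underlying set.\<close>

lemma local_act_triple_relation:
  assumes "on12 s (on23 t (on12 u p)) = on23 s' (on12 t' (on23 u' p))"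
    and "p = (z j, z (Suc j), z (Suc (Suc j)))"
  shows "local_act s j (local_act t (Suc j) (local_act u j z)) =
    local_act s' (Suc j) (local_act t' j (local_act u' (Suc j) z))"
proof -
  have z: "z = put3 j z p" using assms(2) put3_self by metis
  show ?thesis
    \<comment> \<open>The equation \<open>z\<close> has the variable \<open>z\<close> again on its
      right, so each of the two occurrences is expanded exactly once.\<close>
    by (subst (1 2) z) (simp only: local_act_put3 assms(1))
qed

text \<open>The two maps read and change disjoint pairs of positions.\<close>

lemma local_act_commute:
  assumes "i + 2 \<le> j \<or> j + 2 \<le> i"
  shows "local_act s i (local_act t j z) = local_act t j (local_act s i z)"
proof -
  have "i \<noteq> j" "i \<noteq> Suc j" "Suc i \<noteq> j" "Suc i \<noteq> Suc j" using assms by auto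
  then show ?thesis by (auto simp: local_act_def fun_eq_iff)
qed

lemma local_act_involutive:
  assumes "s (s (z j, z (Suc j))) = (z j, z (Suc j))"
  shows "local_act s j (local_act s j z) = z"
  using assms by (auto simp: local_act_def fun_eq_iff)

lemma local_act_PiE:
  assumes "bij_betw s (Y \<times> Y) (Y \<times> Y)" "z \<in> {1..n} \<rightarrow>\<^sub>E Y" "j \<in> {1..<n}"
  shows "local_act s j z \<in> {1..n} \<rightarrow>\<^sub>E Y"
proof -
  have "(z j, z (Suc j)) \<in> Y \<times> Y" using assms(2,3) by auto
  then have "s (z j, z (Suc j)) \<in> Y \<times> Y" using assms(1) by (auto simp: bij_betw_def)
  then show ?thesis
    using assms(2,3) by (auto simp: local_act_def PiE_iff extensional_def mem_Times_iff)
qed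

section \<open>Equivariance of multi-switches\<close>

definition map_tuple :: "nat \<Rightarrow> ('a \<Rightarrow> 'a) \<Rightarrow> (nat \<Rightarrow> 'a) \<Rightarrow> nat \<Rightarrow> 'a" where
  "map_tuple m h p = (\<lambda>i\<in>{..m}. h (p i))"

lemma ms_switch_eq:
  "ms_switch m S (p, q) =
    (\<lambda>i\<in>{..m}. fst (ms_map m S (\<lambda>i\<in>{..m}. (p i, q i)) i),
     \<lambda>i\<in>{..m}. snd (ms_map m S (\<lambda>i\<in>{..m}. (p i, q i)) i))"
  by (simp add: ms_switch_def unzip_tuple_def zip_tuple_def)

lemma proj_eq_iff: "p = q \<longleftrightarrow> (\<forall>s. proj s p = proj s q)"
  by (metis prod.expand proj.simps)

lemma proj_map_prod: "proj s (map_prod h h p) = h (proj s p)"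
  by (cases s) auto

lemma proj_closed: "p \<in> B \<times> B \<Longrightarrow> proj s p \<in> B"
  by (cases s) auto

text \<open>An automorphism need not map \<open>Xs i\<close> into itself, and the words describe the
  components only on \<open>pair_tuples\<close>. Hence both \<open>c\<close> and its image
  \<open>c'\<close> are required to lie there; the claim is then equivariance of words.\<close>

lemma ms_map_automorphism:
  assumes X: "alg_system X" and Xs: "\<forall>i\<in>{..m}. Xs i \<subseteq> carrier X"
    and S: "given_by_words m X Xs S" and h: "h \<in> automorphisms X"
    and c: "c \<in> pair_tuples m (carrier X) Xs" "c' \<in> pair_tuples m (carrier X) Xs"
    and c': "\<And>i. i \<le> m \<Longrightarrow> c' i = map_prod h h (c i)"
    and i: "i \<le> m"
  shows "ms_map m S c' i = map_prod h h (ms_map m S c i)"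
proof (cases "i = 0")
  case True
  have "proj s (ms_zero S c') = h (proj s (ms_zero S c))" for s
  proof -
    obtain w where w: "w \<in> words X ({..m} \<times> UNIV)"
      and eval: "\<And>c. c \<in> pair_tuples m (carrier X) Xs \<Longrightarrow>
        proj s (ms_zero S c) = eval_word X (\<lambda>(i, t). proj t (c i)) w"
      using S unfolding given_by_words_def by blast
    \<comment> \<open>The word for the zeroth component may involve every entry of \<open>c\<close>,
      so all of them must lie in the carrier.\<close>
    have "c i \<in> carrier X \<times> carrier X" if "i \<le> m" for i
    proof -
      have "c i \<in> factor (carrier X) Xs i \<times> factor (carrier X) Xs i"
        using PiE_mem[OF c(1)[unfolded pair_tuples_def], of i] that by simp
      moreover have "factor (carrier X) Xs i \<subseteq> carrier X"
        using Xs that by (simp add: factor_def)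
      ultimately show ?thesis by auto
    qed
    then have "(\<lambda>(i, t). proj t (c i)) \<in> {..m} \<times> UNIV \<rightarrow> carrier X"
      by (auto intro: proj_closed)
    then show ?thesis
      using automorphisms_eval_word[OF X h w, of "\<lambda>(i, t). proj t (c i)" "\<lambda>(i, t). proj t (c' i)"]
        eval c c' by (auto simp: proj_map_prod)
  qed
  then show ?thesis
    using True by (simp add: ms_map_def proj_eq_iff proj_map_prod)
next
  case False
  then have i': "i \<in> {1..m}" using i by auto
  have ci: "c i \<in> Xs i \<times> Xs i" "c' i \<in> Xs i \<times> Xs i"
    using c i False by (auto simp: pair_tuples_def factor_def dest!: PiE_mem[of _ _ _ i])
  have "proj s (ms_comp S i (c' i)) = h (proj s (ms_comp S i (c i)))" for s
  proof -
    obtain w where w: "w \<in> words X UNIV"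
      and eval: "\<And>p. p \<in> Xs i \<times> Xs i \<Longrightarrow>
        proj s (ms_comp S i p) = eval_word X (\<lambda>t. proj t p) w"
      using S i' unfolding given_by_words_def by blast
    have "(\<lambda>t. proj t (c i)) \<in> UNIV \<rightarrow> carrier X"
      using proj_closed[OF ci(1)] Xs i by auto
    then show ?thesis
      using automorphisms_eval_word[OF X h w, of "\<lambda>t. proj t (c i)" "\<lambda>t. proj t (c' i)"]
        eval ci c'[OF i] by (auto simp: proj_map_prod)
  qed
  then show ?thesis
    using i False by (simp add: ms_map_def proj_eq_iff proj_map_prod)
qed

lemma ms_switch_automorphism:
  assumes X: "alg_system X" and Xs: "\<forall>i\<in>{..m}. Xs i \<subseteq> carrier X"
    and S: "given_by_words m X Xs S" and h: "h \<in> automorphisms X"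
    and pq: "p \<in> tuples m (carrier X) Xs" "q \<in> tuples m (carrier X) Xs"
    and hpq: "map_tuple m h p \<in> tuples m (carrier X) Xs" "map_tuple m h q \<in> tuples m (carrier X) Xs"
  shows "ms_switch m S (map_tuple m h p, map_tuple m h q) =
    map_prod (map_tuple m h) (map_tuple m h) (ms_switch m S (p, q))"
proof -
  let ?c = "\<lambda>i\<in>{..m}. (p i, q i)"
  let ?c' = "\<lambda>i\<in>{..m}. (map_tuple m h p i, map_tuple m h q i)"
  have "?c \<in> pair_tuples m (carrier X) Xs" "?c' \<in> pair_tuples m (carrier X) Xs"
    using pq hpq by (auto simp: tuples_def pair_tuples_def PiE_iff)
  then have "ms_map m S ?c' i = map_prod h h (ms_map m S ?c i)" if "i \<le> m" for i
    using that by (intro ms_map_automorphism[OF X Xs S h]) (auto simp: map_tuple_def)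
  then show ?thesis
    by (auto simp: ms_switch_eq map_tuple_def fun_eq_iff)
qed

text \<open>Away from \<open>j\<close> and \<open>Suc j\<close> the local map changes nothing; at
  these two positions the claim is \<open>ms_switch_automorphism\<close>.\<close>

lemma local_act_automorphism:
  fixes X :: "('a, 'f, 'z) alg_system_scheme"
  defines "Y \<equiv> \<lambda>m Xs. tuples m (carrier X) Xs"
  assumes X: "alg_system X" and Xs: "\<forall>i\<in>{..m}. Xs i \<subseteq> carrier X"
    and S: "given_by_words m X Xs S" and h: "h \<in> automorphisms X"
    and z: "z \<in> {1..n} \<rightarrow>\<^sub>E Y m Xs"
    and hz: "(\<lambda>k\<in>{1..n}. map_tuple m h (z k)) \<in> {1..n} \<rightarrow>\<^sub>E Y m Xs"
    and j: "j \<in> {1..<n}"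
  shows "(\<lambda>k\<in>{1..n}. map_tuple m h (local_act (ms_switch m S) j z k)) =
    local_act (ms_switch m S) j (\<lambda>k\<in>{1..n}. map_tuple m h (z k))"
proof -
  have jn: "j \<in> {1..n}" "Suc j \<in> {1..n}" using j by auto
  have "map_tuple m h (z k) \<in> Y m Xs" if "k \<in> {1..n}" for k
    using PiE_mem[OF hz that] that by simp
  then have "ms_switch m S (map_tuple m h (z j), map_tuple m h (z (Suc j))) =
      map_prod (map_tuple m h) (map_tuple m h) (ms_switch m S (z j, z (Suc j)))"
    using jn z by (intro ms_switch_automorphism[OF X Xs S h]) (auto simp: Y_def)
  then show ?thesis
    using jn by (auto simp: local_act_def fun_eq_iff)
qed

section \<open>The representation\<close>

text \<open>Links the formulas prescribing the automorphisms to the local maps. The family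
  \<open>x\<close> is transposed: the position \<open>k\<close> becomes the outer index, and the
  tuple index \<open>i\<close> the inner one.\<close>

lemma gen_image_eq_local_act:
  assumes "i \<le> m" "k \<in> {1..n}" "j \<in> {1..<n}"
  shows "gen_image m S x j i k =
    local_act (ms_switch m S) j (\<lambda>k\<in>{1..n}. \<lambda>i\<in>{..m}. x i k) k i"
proof -
  have "(\<lambda>i\<in>{..m}. ((\<lambda>i\<in>{..m}. x i j) i, (\<lambda>i\<in>{..m}. x i (Suc j)) i)) =
      (\<lambda>i\<in>{..m}. (x i j, x i (Suc j)))"
    by auto
  then show ?thesis
    using assms by (auto simp: gen_image_def local_act_def ms_switch_eq Let_def)
qed

fun vb_act :: "('y \<times> 'y \<Rightarrow> 'y \<times> 'y) \<Rightarrow> ('y \<times> 'y \<Rightarrow> 'y \<times> 'y) \<Rightarrow> vb_gen \<Rightarrow> (nat \<Rightarrow> 'y) \<Rightarrow> nat \<Rightarrow> 'y"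
where
  "vb_act s v (Sigma j) = local_act s j"
| "vb_act s v (Rho j) = local_act v j"

text \<open>Both sides of every relation are positive words, so no inverse local maps occur.
  Although \<open>foldr\<close> applies the last letter first, this is harmless: the words of length
  three are palindromes, and the commutation relations are symmetric.\<close>

lemma vb_rels_act:
  assumes vs: "virtual_switch Y s v" and rel: "(l, r) \<in> vb_rels n"
  obtains gs hs where "l = pos_word gs" "r = pos_word hs"
    "\<And>z. z \<in> {1..n} \<rightarrow>\<^sub>E Y \<Longrightarrow> foldr (vb_act s v) gs z = foldr (vb_act s v) hs z"
proof -
  have triple: "(z i, z (Suc i), z (Suc (Suc i))) \<in> Y \<times> Y \<times> Y"
    if "z \<in> {1..n} \<rightarrow>\<^sub>E Y" "1 \<le> i" "i + 2 \<le> n" for z i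
  proof -
    have "i \<in> {1..n}" "Suc i \<in> {1..n}" "Suc (Suc i) \<in> {1..n}" using that(2,3) by auto
    then show ?thesis using PiE_mem[OF that(1)] by blast
  qed
  from rel consider
      (1) i where "1 \<le> i" "i + 2 \<le> n" "l = pos_word [Sigma i, Sigma (i+1), Sigma i]"
        "r = pos_word [Sigma (i+1), Sigma i, Sigma (i+1)]"
    | (2) i where "1 \<le> i" "i + 2 \<le> n" "l = pos_word [Rho i, Rho (i+1), Rho i]"
        "r = pos_word [Rho (i+1), Rho i, Rho (i+1)]"
    | (3) i where "1 \<le> i" "i + 2 \<le> n" "l = pos_word [Rho (i+1), Sigma i, Rho (i+1)]"
        "r = pos_word [Rho i, Sigma (i+1), Rho i]"
    | (4) i j where "i + 2 \<le> j \<or> j + 2 \<le> i" "l = pos_word [Sigma i, Sigma j]"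
        "r = pos_word [Sigma j, Sigma i]"
    | (5) i j where "i + 2 \<le> j \<or> j + 2 \<le> i" "l = pos_word [Rho i, Rho j]"
        "r = pos_word [Rho j, Rho i]"
    | (6) i j where "i + 2 \<le> j \<or> j + 2 \<le> i" "l = pos_word [Sigma i, Rho j]"
        "r = pos_word [Rho j, Sigma i]"
    | (7) i where "i \<in> {1..<n}" "l = pos_word [Rho i, Rho i]" "r = pos_word []"
    unfolding vb_rels_def by (elim UnE; blast)
  then show thesis
  proof cases
    case 1
    show ?thesis
    proof (rule that[OF 1(3,4)])
      fix z assume "z \<in> {1..n} \<rightarrow>\<^sub>E Y"
      from local_act_triple_relation[OF _ HOL.refl, of s s s z i s s s] triple[OF this 1(1,2)] vs
      show "foldr (vb_act s v) [Sigma i, Sigma (i+1), Sigma i] z =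
          foldr (vb_act s v) [Sigma (i+1), Sigma i, Sigma (i+1)] z"
        by (simp add: virtual_switch_def switch_def)
    qed
  next
    case 2
    show ?thesis
    proof (rule that[OF 2(3,4)])
      fix z assume "z \<in> {1..n} \<rightarrow>\<^sub>E Y"
      from local_act_triple_relation[OF _ HOL.refl, of v v v z i v v v] triple[OF this 2(1,2)] vs
      show "foldr (vb_act s v) [Rho i, Rho (i+1), Rho i] z =
          foldr (vb_act s v) [Rho (i+1), Rho i, Rho (i+1)] z"
        by (simp add: virtual_switch_def switch_def)
    qed
  next
    case 3
    show ?thesis
    proof (rule that[OF 3(3,4)])
      fix z assume "z \<in> {1..n} \<rightarrow>\<^sub>E Y"
      \<comment> \<open>For these instances the premise is the mixed axiom of a virtual switch with
        its sides exchanged.\<close>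
      from local_act_triple_relation[OF _ HOL.refl, of v s v z i v s v] triple[OF this 3(1,2)] vs
      show "foldr (vb_act s v) [Rho (i+1), Sigma i, Rho (i+1)] z =
          foldr (vb_act s v) [Rho i, Sigma (i+1), Rho i] z"
        by (simp add: virtual_switch_def)
    qed
  next
    case 4
    show ?thesis
      by (rule that[OF 4(2,3)]) (simp add: local_act_commute[OF 4(1)])
  next
    case 5
    show ?thesis
      by (rule that[OF 5(2,3)]) (simp add: local_act_commute[OF 5(1)])
  next
    case 6
    show ?thesis
      by (rule that[OF 6(2,3)]) (simp add: local_act_commute[OF 6(1)])
  next
    case 7
    show ?thesis
    proof (rule that[OF 7(2,3)])
      fix z assume "z \<in> {1..n} \<rightarrow>\<^sub>E Y"
      then have "(z i, z (Suc i)) \<in> Y \<times> Y" using 7(1) by auto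
      then show "foldr (vb_act s v) [Rho i, Rho i] z = foldr (vb_act s v) [] z"
        using vs by (simp add: virtual_switch_def involutive_def local_act_involutive)
    qed
  qed
qed

theorem theorem2:
  fixes n m :: nat
    and X :: "('a, 'f) alg_system"
    and Xs :: "nat \<Rightarrow> 'a set"
    and x :: "nat \<Rightarrow> nat \<Rightarrow> 'a"
    and S V :: "'a multi_switch_data"
    and Rf Gf :: "nat \<Rightarrow> 'a \<Rightarrow> 'a"
  assumes "n \<ge> 2"
    and "alg_system X"
    and "\<forall>i\<in>{..m}. Xs i \<subseteq> carrier X"
    and "\<forall>i\<in>{..m}. \<forall>k\<in>{1..n}. x i k \<in> Xs i"
    and "\<forall>i\<in>{..m}. \<forall>k\<in>{..m}. i \<noteq> k \<longrightarrow> x i ` {1..n} \<inter> x k ` {1..n} = {}"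
    and "generated X {x i j | i j. i \<in> {..m} \<and> j \<in> {1..n}} = carrier X"
    and "AVMS n m X Xs x S V"
    and "\<forall>j\<in>{1..<n}. Rf j \<in> carrier (Aut X) \<and> extends_gen_map n m x S j (Rf j)"
    and "\<forall>j\<in>{1..<n}. Gf j \<in> carrier (Aut X) \<and> extends_gen_map n m x V j (Gf j)"
  shows "\<exists>\<phi>. group_hom (VB n) (Aut X) \<phi> \<and>
           (\<forall>j\<in>{1..<n}. \<phi> (vb_sigma n j) = Rf j \<and> \<phi> (vb_rho n j) = Gf j)"
proof -
  note X = assms(2) and Xs = assms(3) and avms = assms(7)
  define Y where "Y = tuples m (carrier X) Xs"
  define x0 where "x0 = (\<lambda>k\<in>{1..n}. \<lambda>i\<in>{..m}. x i k)"
  define lift where "lift h z = (\<lambda>k\<in>{1..n}. map_tuple m h (z k))" for h and z :: "nat \<Rightarrow> nat \<Rightarrow> 'a"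
  define f where "f g = (case g of Sigma j \<Rightarrow> Rf j | Rho j \<Rightarrow> Gf j)" for g
  let ?act = "vb_act (ms_switch m S) (ms_switch m V)"
  have xc: "x i k \<in> carrier X" if "i \<le> m" "k \<in> {1..n}" for i k
    using assms(3,4) that by blast
  have x0: "x0 \<in> {1..n} \<rightarrow>\<^sub>E Y"
    using assms(4) xc by (auto simp: x0_def Y_def tuples_def factor_def PiE_iff)
  have vs: "virtual_switch Y (ms_switch m S) (ms_switch m V)"
    and words: "given_by_words m X Xs S" "given_by_words m X Xs V"
    using avms by (auto simp: AVMS_def virtual_multi_switch_def Y_def)
  then have bij: "bij_betw (ms_switch m S) (Y \<times> Y) (Y \<times> Y)"
      "bij_betw (ms_switch m V) (Y \<times> Y) (Y \<times> Y)"
    by (auto simp: virtual_switch_def switch_def)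
  interpret Aut: group "Aut X"
    using X by (rule group_Aut)
  have f: "f \<in> vb_gens n \<rightarrow> carrier (Aut X)"
    using assms(8,9) by (auto simp: f_def vb_gens_def)
  have act_PiE: "?act g z \<in> {1..n} \<rightarrow>\<^sub>E Y" if "g \<in> vb_gens n" "z \<in> {1..n} \<rightarrow>\<^sub>E Y" for g z
    using that unfolding vb_gens_def
    by (elim UnE imageE) (simp_all only: vb_act.simps local_act_PiE[OF bij(1)] local_act_PiE[OF bij(2)])
  \<comment> \<open>The automorphisms are prescribed only on the generators, so this identity is
    available at \<open>x0\<close> and not at arbitrary points.\<close>
  have f_x0: "lift (f g) x0 = ?act g x0" if "g \<in> vb_gens n" for g
  proof (rule extensionalityI)
    fix k assume k: "k \<in> {1..n}"
    have *: "lift h x0 k = local_act (ms_switch m T) j x0 k"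
      if "extends_gen_map n m x T j h" "j \<in> {1..<n}" for T j h
    proof (rule extensionalityI)
      show "lift h x0 k \<in> extensional {..m}"
        using k by (simp add: lift_def map_tuple_def)
      show "local_act (ms_switch m T) j x0 k \<in> extensional {..m}"
        using k by (auto simp: local_act_def ms_switch_eq x0_def)
      fix i assume "i \<in> {..m}"
      then show "lift h x0 k i = local_act (ms_switch m T) j x0 k i"
        using that k gen_image_eq_local_act[of i m k n j T x]
        by (simp add: extends_gen_map_def lift_def map_tuple_def x0_def)
    qed
    show "lift (f g) x0 k = ?act g x0 k"
      using that unfolding vb_gens_def
    proof (elim UnE imageE)
      fix j assume "g = Sigma j" "j \<in> {1..<n}"
      then show ?thesis using assms(8) *[of S j "Rf j"] by (simp add: f_def)
    next
      fix j assume "g = Rho j" "j \<in> {1..<n}"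
      then show ?thesis using assms(9) *[of V j "Gf j"] by (simp add: f_def)
    qed
  next
    show "?act g x0 \<in> extensional {1..n}"
      using act_PiE[OF that x0] by (simp add: PiE_iff)
  qed (simp add: lift_def)
  have lift_act: "lift h (?act g z) = ?act g (lift h z)"
    if "h \<in> automorphisms X" "g \<in> vb_gens n" "z \<in> {1..n} \<rightarrow>\<^sub>E Y" "lift h z \<in> {1..n} \<rightarrow>\<^sub>E Y" for h g z
    using that unfolding vb_gens_def lift_def Y_def
    by (elim UnE imageE) (simp_all only: vb_act.simps
        local_act_automorphism[OF X Xs words(1)] local_act_automorphism[OF X Xs words(2)])
  \<comment> \<open>The local maps of a word compose in the order opposite to the automorphisms.\<close>
  have eval_x0: "lift (gword_eval (Aut X) f (pos_word gs)) x0 = foldr ?act gs x0 \<and>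
      foldr ?act gs x0 \<in> {1..n} \<rightarrow>\<^sub>E Y"
    if "set gs \<subseteq> vb_gens n" for gs
    using that
  proof (induction gs)
    case Nil
    \<comment> \<open>The unit of \<open>Aut X\<close> is the identity only on the carrier, which
      contains all entries of \<open>x0\<close>.\<close>
    have "lift \<one>\<^bsub>Aut X\<^esub> x0 = x0"
      using xc by (auto simp: lift_def map_tuple_def x0_def Aut_def fun_eq_iff)
    then show ?case using x0 by simp
  next
    case (Cons g gs)
    let ?h = "gword_eval (Aut X) f (pos_word gs)"
    have g: "g \<in> vb_gens n" and gs: "pos_word gs \<in> gwords (vb_gens n)"
      using Cons.prems by (auto simp: gwords_def)
    have h: "?h \<in> automorphisms X"
      using gword_eval_closed[OF Aut.group_axioms f gs] by (simp add: Aut_def)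
    \<comment> \<open>The first letter acts first, so \<open>f g\<close> is innermost and
      \<open>f_x0\<close> applies to it.\<close>
    have "lift (f g \<otimes>\<^bsub>Aut X\<^esub> ?h) x0 = lift ?h (lift (f g) x0)"
      using xc by (auto simp: lift_def map_tuple_def x0_def Aut_def compose_def fun_eq_iff)
    \<comment> \<open>Moving \<open>lift ?h\<close> past the local map needs
      \<open>lift ?h x0\<close> to be a point over \<open>Y\<close>. The second conjunct of the
      induction hypothesis provides this.\<close>
    also have "\<dots> = ?act g (lift ?h x0)"
      unfolding f_x0[OF g] by (rule lift_act) (use h g x0 Cons in auto)
    finally show ?case
      using Cons act_PiE[OF g] by simp
  qed
  have "\<exists>\<phi>. group_hom (VB n) (Aut X) \<phi> \<and>
      (\<forall>g\<in>vb_gens n. \<phi> (pres_gen (vb_gens n) (vb_rels n) g) = f g)"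
    unfolding VB_def
  proof (rule presented_group_hom_exists[OF Aut.group_axioms f])
    fix l r assume lr: "(l, r) \<in> vb_rels n" "l \<in> gwords (vb_gens n)" "r \<in> gwords (vb_gens n)"
    obtain gs hs where gs: "l = pos_word gs" "r = pos_word hs"
      and act: "\<And>z. z \<in> {1..n} \<rightarrow>\<^sub>E Y \<Longrightarrow> foldr ?act gs z = foldr ?act hs z"
      using vb_rels_act[OF vs lr(1)] by blast
    have "set gs \<subseteq> vb_gens n" "set hs \<subseteq> vb_gens n"
      using lr gs by (auto simp: gwords_def)
    then have eq: "lift (gword_eval (Aut X) f l) x0 = lift (gword_eval (Aut X) f r) x0"
      using eval_x0 act[OF x0] gs by simp
    show "gword_eval (Aut X) f l = gword_eval (Aut X) f r"
    proof (rule automorphisms_eqI[OF _ _ _ assms(6)])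
      show "gword_eval (Aut X) f l \<in> automorphisms X" "gword_eval (Aut X) f r \<in> automorphisms X"
        using gword_eval_closed[OF Aut.group_axioms f] lr by (auto simp: Aut_def)
      show "{x i j | i j. i \<in> {..m} \<and> j \<in> {1..n}} \<subseteq> carrier X"
        using xc by auto
      fix b assume "b \<in> {x i j | i j. i \<in> {..m} \<and> j \<in> {1..n}}"
      then obtain i k where b: "b = x i k" "i \<le> m" "k \<in> {1..n}" by auto
      \<comment> \<open>The image of \<open>x i k\<close> is entry \<open>i\<close> of coordinate
        \<open>k\<close> of the lifted point.\<close>
      show "gword_eval (Aut X) f l b = gword_eval (Aut X) f r b"
        using fun_cong[OF fun_cong[OF eq, of k], of i] b
        by (simp add: lift_def map_tuple_def x0_def)
    qed
  qed
  then show ?thesis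
    by (auto simp: vb_sigma_def vb_rho_def vb_gens_def f_def)
qed

end
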